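(* Let $f:\mathcal X\to\mathbb R$ be continuously differentiable, attaining its minimum at $x^\ast$. Let $1<p\le\infty$ and $0<\delta<\infty$, and let $(x_k)_{k\ge0}$ be the iterates of a $\delta$-descent algorithm of order $p$ for $f$. Put $E_0:=f(x_0)-f(x^\ast)$. Then for every $k\ge1$, $$\min_{0\le s\le k}\|\nabla f(x_s)\|_\ast\le\left(\frac{E_0}{\delta k}\right)^{\frac{p-1}{p}}.$$
   Context: $\mathcal X$ is a finite-dimensional real vector space with norm $\|v\|=\sqrt{\langle v,Bv\rangle}$ and dual norm $\|s\|_\ast=\sqrt{\langle s,B^{-1}s\rangle}$ on $\mathcal X^\ast$, where $B:\mathcal X\to\mathcal X^\ast$ is a positive definite self-adjoint operator. An algorithm $x_{k+1}=\mathcal A(x_k)$ is a $\delta$-descent algorithm of order $p$ (with $1<p\le\infty$, $0<\delta<\infty$) if it satisfies either (i) $\frac{f(x_{k+1})-f(x_k)}{\delta}\le-\|\nabla f(x_k)\|_\ast^{\frac{p}{p-1}}$ for all $k\ge0$, or (ii) $\frac{f(x_{k+1})-f(x_k)}{\delta}\le-\|\nabla f(x_{k+1})\|_\ast^{\frac{p}{p-1}}$ for all $k\ge0$. For $p=\infty$, expressions in $p$ are read as limits, so $\frac{p}{p-1}=\frac{p-1}{p}=1$. *)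

theory Defs
  imports "HOL-Analysis.Analysis"
begin

text \<open>
  The space \<open>\<X>\<close> is a type of class \<^class>\<open>real_normed_vector\<close> that has a finite spanning set,
  and the dual space is the type of bounded linear functionals on it. The class norm is arbitrary;
  as all norms on a finite-dimensional space are equivalent, it only provides the topology (and with
  it differentiability). The operator \<open>B\<close> determines the inner product, and with it
  the dual norm.
\<close>

definition pos_def_self_adjoint :: "('a::real_normed_vector \<Rightarrow> ('a \<Rightarrow>\<^sub>L real)) \<Rightarrow> bool" where
  "pos_def_self_adjoint B \<longleftrightarrow>
     linear B \<and>
     (\<forall>u v. blinfun_apply (B u) v = blinfun_apply (B v) u) \<and>
     (\<forall>v. v \<noteq> 0 \<longrightarrow> 0 < blinfun_apply (B v) v)"

text \<open>
  Positive definiteness and finite dimension make \<open>B\<close> a bijection onto the dual space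
  (lemma \<open>pos_def_self_adjoint_bij\<close>), so \<^term>\<open>inv B\<close> is its genuine inverse.
\<close>

definition dual_norm :: "('a::real_normed_vector \<Rightarrow> ('a \<Rightarrow>\<^sub>L real)) \<Rightarrow> ('a \<Rightarrow>\<^sub>L real) \<Rightarrow> real" where
  "dual_norm B s = sqrt (blinfun_apply s (inv B s))"

lemma pos_def_self_adjoint_solve:
  fixes B :: "'a::real_normed_vector \<Rightarrow> ('a \<Rightarrow>\<^sub>L real)"
  assumes B: "pos_def_self_adjoint B" and "finite S"
  shows "\<exists>v. v \<in> span S \<and> (\<forall>t\<in>span S. blinfun_apply (B v) t = blinfun_apply s t)"
  using \<open>finite S\<close>
proof (induction S arbitrary: s)
  case empty
  then show ?case by (auto intro!: exI[of _ 0])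
next
  case (insert a S)
  have lin: "linear B" and pos: "\<And>v. v \<noteq> 0 \<Longrightarrow> 0 < blinfun_apply (B v) v"
    using B by (auto simp: pos_def_self_adjoint_def)
  obtain v where v: "v \<in> span S" "\<And>t. t \<in> span S \<Longrightarrow> blinfun_apply (B v) t = blinfun_apply s t"
    using insert.IH[of s] by blast
  obtain w where w: "w \<in> span S" "\<And>t. t \<in> span S \<Longrightarrow> blinfun_apply (B w) t = blinfun_apply (B a) t"
    using insert.IH[of "B a"] by blast
  define d where "d = a - w"
  have d0: "blinfun_apply (B d) t = 0" if "t \<in> span S" for t
    using w(2)[OF that] by (simp add: d_def linear_diff[OF lin] blinfun.diff_left)
  define c where "c = (blinfun_apply s d - blinfun_apply (B v) d) / blinfun_apply (B d) d"
  have c: "c * blinfun_apply (B d) d = blinfun_apply s d - blinfun_apply (B v) d"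
  proof (cases "d = 0")
    case False
    then show ?thesis using pos[of d] by (simp add: c_def)
  qed (simp add: blinfun.zero_right)
  have sub: "span S \<subseteq> span (insert a S)" by (intro span_mono) auto
  have "d \<in> span (insert a S)"
    unfolding d_def using w(1) sub by (intro span_diff) (auto intro: span_base)
  then have "v + c *\<^sub>R d \<in> span (insert a S)"
    using v(1) sub by (intro span_add span_scale) auto
  moreover have "blinfun_apply (B (v + c *\<^sub>R d)) t = blinfun_apply s t"
    if t: "t \<in> span (insert a S)" for t
  proof -
    obtain k where k: "t - k *\<^sub>R a \<in> span S" using t by (auto simp: span_insert)
    define u where "u = t - k *\<^sub>R d"
    have "u = (t - k *\<^sub>R a) + k *\<^sub>R w" by (simp add: u_def d_def algebra_simps)
    then have u: "u \<in> span S" using k w(1) by (metis span_add span_scale)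
    have tu: "t = u + k *\<^sub>R d" by (simp add: u_def)
    have "blinfun_apply (B (v + c *\<^sub>R d)) t
            = blinfun_apply s u + k * (blinfun_apply (B v) d + c * blinfun_apply (B d) d)"
      by (simp add: tu linear_add[OF lin] linear_scale[OF lin] blinfun.add_left blinfun.add_right
          blinfun.scaleR_left blinfun.scaleR_right d0[OF u] v(2)[OF u] algebra_simps)
    also have "\<dots> = blinfun_apply s t"
      by (simp add: c tu blinfun.add_right blinfun.scaleR_right)
    finally show ?thesis .
  qed
  ultimately show ?case by blast
qed

lemma pos_def_self_adjoint_bij:
  fixes B :: "'a::real_normed_vector \<Rightarrow> ('a \<Rightarrow>\<^sub>L real)"
  assumes "\<exists>S::'a set. finite S \<and> span S = UNIV" and B: "pos_def_self_adjoint B"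
  shows "bij B"
proof -
  have lin: "linear B" and pos: "\<And>v. v \<noteq> 0 \<Longrightarrow> 0 < blinfun_apply (B v) v"
    using B by (auto simp: pos_def_self_adjoint_def)
  have "inj B"
    unfolding linear_injective_0[OF lin] using pos by (metis less_irrefl blinfun.zero_left)
  moreover obtain S :: "'a set" where S: "finite S" "span S = UNIV" using assms(1) by blast
  have "\<exists>v. s = B v" for s
    using pos_def_self_adjoint_solve[OF B S(1), of s] S(2) by (metis UNIV_I blinfun_eqI)
  then have "surj B" by (auto simp: surj_def)
  ultimately show ?thesis by (simp add: bij_def)
qed

text \<open>The gradient is an element of the dual space, namely the derivative itself.\<close>

definition gradient :: "('a::real_normed_vector \<Rightarrow> real) \<Rightarrow> 'a \<Rightarrow> ('a \<Rightarrow>\<^sub>L real)" where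
  "gradient f x = Blinfun (frechet_derivative f (at x))"

definition continuously_differentiable :: "('a::real_normed_vector \<Rightarrow> real) \<Rightarrow> bool" where
  "continuously_differentiable f \<longleftrightarrow>
     (\<forall>x. f differentiable (at x)) \<and> continuous_on UNIV (gradient f)"

text \<open>
  The exponents \<open>p / (p - 1)\<close> and \<open>(p - 1) / p\<close> for \<open>1 < p \<le> \<infinity>\<close>. The value at \<open>\<infinity>\<close> is the limit;
  extended real arithmetic would yield \<open>\<infinity> / \<infinity> = 0\<close> instead.
\<close>

definition descent_exponent :: "ereal \<Rightarrow> real" where
  "descent_exponent p =
     (if p = \<infinity> then 1 else real_of_ereal p / (real_of_ereal p - 1))"

definition rate_exponent :: "ereal \<Rightarrow> real" where
  "rate_exponent p =
     (if p = \<infinity> then 1 else (real_of_ereal p - 1) / real_of_ereal p)"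

text \<open>
  The sequence \<open>x\<close> is generated by the algorithm \<open>\<A>\<close>, and the descent inequalities are required
  along this sequence only.
\<close>

definition descent_algorithm ::
  "('a::real_normed_vector \<Rightarrow> ('a \<Rightarrow>\<^sub>L real)) \<Rightarrow> ('a \<Rightarrow> real) \<Rightarrow> real \<Rightarrow> ereal
     \<Rightarrow> ('a \<Rightarrow> 'a) \<Rightarrow> (nat \<Rightarrow> 'a) \<Rightarrow> bool" where
  "descent_algorithm B f \<delta> p \<A> x \<longleftrightarrow>
     (\<forall>k. x (Suc k) = \<A> (x k)) \<and>
     ((\<forall>k. (f (x (Suc k)) - f (x k)) / \<delta>
              \<le> - (dual_norm B (gradient f (x k)) powr descent_exponent p)) \<or>
      (\<forall>k. (f (x (Suc k)) - f (x k)) / \<delta>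
              \<le> - (dual_norm B (gradient f (x (Suc k))) powr descent_exponent p)))"

end

theory Submission imports Defs begin

text \<open>
  Either inequality bounds the decrease of \<open>f / \<delta>\<close> over one step from below by the \<open>q\<close>-th power,
  \<open>q = p / (p - 1)\<close>, of some gradient norm among those of the iterates \<open>0, \<dots>, k\<close>, hence by the
  \<open>q\<close>-th power of their minimum \<open>m\<close>. Telescoping over \<open>k\<close> steps gives \<open>k m\<^sup>q \<le> E\<^sub>0 / \<delta>\<close>; now take
  the power \<open>1 / q = (p - 1) / p\<close>.
\<close>

text \<open>\<open>sqrt\<close> is negative on negative arguments, so the radicand needs a sign.
  Finite dimension makes \<open>B\<close> surjective, hence \<open>s = B v\<close> for
  \<open>v = inv B s\<close>, and the radicand is the quadratic form of \<open>B\<close> at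
  \<open>v\<close>.\<close>

lemma dual_norm_nonneg:
  fixes B :: "'a::real_normed_vector \<Rightarrow> ('a \<Rightarrow>\<^sub>L real)"
  assumes "\<exists>S::'a set. finite S \<and> span S = UNIV" and B: "pos_def_self_adjoint B"
  shows "0 \<le> dual_norm B s"
proof -
  have "surj B"
    using pos_def_self_adjoint_bij[OF assms] by (rule bij_is_surj)
  then have "blinfun_apply s (inv B s) = blinfun_apply (B (inv B s)) (inv B s)"
    by (simp add: surj_f_inv_f)
  also have "\<dots> \<ge> 0"
    using B by (cases "inv B s = 0") (auto simp: pos_def_self_adjoint_def blinfun.zero_right less_imp_le)
  finally show ?thesis
    by (simp add: dual_norm_def)
qed

lemma descent_exponent_mult_rate_exponent:
  assumes "1 < p"
  shows "descent_exponent p * rate_exponent p = 1"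
  using assms by (cases p) (auto simp: descent_exponent_def rate_exponent_def)

lemma rate_exponent_pos:
  assumes "1 < p"
  shows "0 < rate_exponent p"
  using assms by (cases p) (auto simp: rate_exponent_def)

lemma mult_le_of_const_decrease:
  fixes F :: "nat \<Rightarrow> real"
  assumes "\<And>n. n < k \<Longrightarrow> c \<le> F n - F (Suc n)"
  shows "real k * c \<le> F 0 - F k"
proof -
  have "real k * c = (\<Sum>n<k. c)" by simp
  also have "\<dots> \<le> (\<Sum>n<k. F n - F (Suc n))"
    using assms by (intro sum_mono) simp
  also have "\<dots> = F 0 - F k"
    by (rule sum_lessThan_telescope')
  finally show ?thesis .
qed

theorem theorem1:
  fixes B :: "'a::real_normed_vector \<Rightarrow> ('a \<Rightarrow>\<^sub>L real)"
    and f :: "'a \<Rightarrow> real"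
    and xstar :: 'a
    and p :: ereal
    and \<delta> :: real
    and \<A> :: "'a \<Rightarrow> 'a"
    and x :: "nat \<Rightarrow> 'a"
    and E0 :: real
    and k :: nat
  assumes "\<exists>S::'a set. finite S \<and> span S = UNIV"
    and "pos_def_self_adjoint B"
    and "continuously_differentiable f"
    and "\<forall>y. f xstar \<le> f y"
    and "1 < p" and "p \<le> \<infinity>"
    and "0 < \<delta>"
    and "descent_algorithm B f \<delta> p \<A> x"
    and "E0 = f (x 0) - f xstar"
    and "1 \<le> k"
  shows "(MIN s\<in>{0..k}. dual_norm B (gradient f (x s)))
           \<le> (E0 / (\<delta> * real k)) powr rate_exponent p"
proof -
  define g where "g n = dual_norm B (gradient f (x n))" for n
  define q where "q = descent_exponent p"
  define r where "r = rate_exponent p"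
  define m where "m = (MIN s\<in>{0..k}. g s)"
  have qr: "q * r = 1" and r: "0 < r"
    using descent_exponent_mult_rate_exponent rate_exponent_pos \<open>1 < p\<close> by (auto simp: q_def r_def)
  have q: "0 < q"
    using qr r by (metis zero_less_mult_pos2 zero_less_one)
  \<comment> \<open>The minimum is attained, so \<open>m\<close> is itself a dual norm and inherits
    nonnegativity, which monotonicity of \<open>powr\<close> in its base requires.\<close>
  have "m \<in> g ` {0..k}"
    unfolding m_def by (intro Min_in) auto
  then have m0: "0 \<le> m"
    using dual_norm_nonneg assms(1,2) by (auto simp: g_def)
  have m_powr_le: "m powr q \<le> g s powr q" if "s \<le> k" for s
    using that m0 q by (intro powr_mono2) (auto simp: m_def)
  have descent: "(\<forall>n. (f (x (Suc n)) - f (x n)) / \<delta> \<le> - (g n powr q)) \<or>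
      (\<forall>n. (f (x (Suc n)) - f (x n)) / \<delta> \<le> - (g (Suc n) powr q))"
    using assms(8) by (auto simp: descent_algorithm_def g_def q_def)
  \<comment> \<open>The first alternative involves the norm at index \<open>n\<close>, the second
    that at \<open>Suc n\<close>; \<open>n < k\<close> keeps both indices in
    \<open>{0..k}\<close>.\<close>
  have "m powr q \<le> f (x n) / \<delta> - f (x (Suc n)) / \<delta>" if "n < k" for n
    using descent m_powr_le[of n] m_powr_le[of "Suc n"] that
    by (smt (verit) Suc_leI diff_divide_distrib less_imp_le)
  then have "real k * m powr q \<le> f (x 0) / \<delta> - f (x k) / \<delta>"
    by (rule mult_le_of_const_decrease)
  \<comment> \<open>Minimality of \<open>xstar\<close> bounds the remaining endpoint value
    \<open>f (x k)\<close> from below.\<close>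
  also have "\<dots> \<le> E0 / \<delta>"
    using assms(4,7,9) by (simp add: diff_divide_distrib divide_right_mono)
  finally have "m powr q \<le> E0 / (\<delta> * real k)"
    using \<open>1 \<le> k\<close> \<open>0 < \<delta>\<close> by (simp add: field_simps)
  then have "(m powr q) powr r \<le> (E0 / (\<delta> * real k)) powr r"
    using r by (intro powr_mono2) auto
  \<comment> \<open>The exponents multiply to 1, and \<open>m powr 1 = m\<close> because
    \<open>0 \<le> m\<close>; this includes a vanishing gradient, \<open>m = 0\<close>.\<close>
  moreover have "(m powr q) powr r = m"
    using m0 qr by (simp add: powr_powr)
  ultimately show ?thesis
    by (simp add: m_def g_def r_def)
qed

end
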